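(* Let $X,Y$ be Banach spaces and $T\in\mathcal{L}(X,Y)$. Then $cc_{n}(T)\leq cc(T)\leq 2\,cc_{n}(T)$.
   Context: Banach spaces are real or complex; $\mathcal{L}(X,Y)$ is the space of continuous linear maps from $X$ to $Y$; $B_X$ is the closed unit ball of $X$. For a bounded sequence $(x_n)_n$ in a Banach space, $ca((x_n)_n)=\inf_n\sup\{\|x_k-x_l\|:k,l\geq n\}$. For $T\in\mathcal{L}(X,Y)$, $cc(T)=\sup\{ca((Tx_n)_n):(x_n)_n\subset B_X \text{ weakly Cauchy}\}$ and $cc_n(T)=\sup\{\limsup_n\|Tx_n\|:(x_n)_n\subset B_X\text{ weakly null}\}$ (here the subscript $n$ in $cc_n$ is part of the name, not an index). *)

theory Defs
  imports "HOL-Analysis.Analysis"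
begin

text \<open>
  Banach spaces over a scalar field that is either the reals or the complex numbers. By the
  Gelfand--Mazur theorem, these two are, up to isometric isomorphism, the only instances of
  \<^class>\<open>real_normed_field\<close>. Since \<^class>\<open>banach\<close> only provides real scalars, the scalar
  multiplication is an explicit parameter.
\<close>

locale banach_space_over = vector_space scale
  for scale :: "'k::real_normed_field \<Rightarrow> 'a::banach \<Rightarrow> 'a" +
  assumes norm_scale: "norm (scale c x) = norm c * norm x"
    and scale_of_real: "scale (of_real r) x = r *\<^sub>R x"

lemma banach_space_over_real: "banach_space_over (scaleR :: real \<Rightarrow> 'a::banach \<Rightarrow> 'a)"
  by unfold_locales (auto simp: algebra_simps)

lemma banach_space_over_self:
  "banach_space_over ((*) :: 'k::{real_normed_field,banach} \<Rightarrow> 'k \<Rightarrow> 'k)"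
  by unfold_locales (auto simp: algebra_simps norm_mult scaleR_conv_of_real)

definition continuous_linear ::
  "('k::real_normed_field \<Rightarrow> 'a::real_normed_vector \<Rightarrow> 'a) \<Rightarrow>
   ('k \<Rightarrow> 'b::real_normed_vector \<Rightarrow> 'b) \<Rightarrow> ('a \<Rightarrow> 'b) \<Rightarrow> bool" where
  "continuous_linear s t T \<longleftrightarrow> Vector_Spaces.linear s t T \<and> continuous_on UNIV T"

definition weakly_Cauchy ::
  "('k::real_normed_field \<Rightarrow> 'a::real_normed_vector \<Rightarrow> 'a) \<Rightarrow> (nat \<Rightarrow> 'a) \<Rightarrow> bool" where
  "weakly_Cauchy s x \<longleftrightarrow>
     (\<forall>f :: 'a \<Rightarrow> 'k. continuous_linear s (*) f \<longrightarrow> Cauchy (\<lambda>n. f (x n)))"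

definition weakly_null ::
  "('k::real_normed_field \<Rightarrow> 'a::real_normed_vector \<Rightarrow> 'a) \<Rightarrow> (nat \<Rightarrow> 'a) \<Rightarrow> bool" where
  "weakly_null s x \<longleftrightarrow>
     (\<forall>f :: 'a \<Rightarrow> 'k. continuous_linear s (*) f \<longrightarrow> (\<lambda>n. f (x n)) \<longlonglongrightarrow> 0)"

text \<open>
  The quantities below take values in \<^typ>\<open>ereal\<close>, so that all suprema and infima exist
  outright.
\<close>

definition ca :: "(nat \<Rightarrow> 'a::real_normed_vector) \<Rightarrow> ereal" where
  "ca x = (INF n. Sup {ereal (norm (x k - x l)) | k l. k \<ge> n \<and> l \<ge> n})"

definition cc ::
  "('k::real_normed_field \<Rightarrow> 'a::real_normed_vector \<Rightarrow> 'a) \<Rightarrow>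
   ('a \<Rightarrow> 'b::real_normed_vector) \<Rightarrow> ereal" where
  "cc s T = Sup {ca (\<lambda>n. T (x n)) | x. range x \<subseteq> cball 0 1 \<and> weakly_Cauchy s x}"

definition cc_n ::
  "('k::real_normed_field \<Rightarrow> 'a::real_normed_vector \<Rightarrow> 'a) \<Rightarrow>
   ('a \<Rightarrow> 'b::real_normed_vector) \<Rightarrow> ereal" where
  "cc_n s T =
     Sup {limsup (\<lambda>n. ereal (norm (T (x n)))) | x. range x \<subseteq> cball 0 1 \<and> weakly_null s x}"

end

theory Submission imports Defs begin

text \<open>
  Both inequalities come from rebuilding one kind of sequence out of the other.

  To a weakly null sequence \<open>x\<close> in the unit ball, interleave zeros:
  \<open>x 0, 0, x 1, 0, x 2, 0, \<dots>\<close> is again weakly null, hence weakly Cauchy, and stays in the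
  ball. Comparing each \<open>T (x m)\<close> with the neighbouring \<open>0\<close> shows that the oscillation of the
  image is at least \<open>limsup \<parallel>T (x m)\<parallel>\<close> (lemma \<open>limsup_norm_le_ca_interleave_zero\<close>).

  Conversely, if \<open>x\<close> is weakly Cauchy in the unit ball and \<open>z < ca (T \<circ> x)\<close>, then there are
  \<open>k n, l n \<ge> n\<close> with \<open>\<parallel>T (x (k n)) - T (x (l n))\<parallel> > z\<close>. The differences
  \<open>x (k n) - x (l n)\<close> are weakly null but only lie in the ball of radius \<open>2\<close>; halving
  them costs the factor \<open>2\<close> (lemma \<open>ca_le_twice_cc_n\<close>).
\<close>

lemma linear_scaleR_over:
  assumes "banach_space_over s" "banach_space_over t" "Vector_Spaces.linear s t T"
  shows "T (r *\<^sub>R x) = r *\<^sub>R T x"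
proof -
  interpret S: banach_space_over s by fact
  interpret T: banach_space_over t by fact
  interpret L: Vector_Spaces.linear s t T by fact
  show ?thesis
    by (metis S.scale_of_real T.scale_of_real L.scale)
qed

lemma weakly_null_imp_weakly_Cauchy: "weakly_null s x \<Longrightarrow> weakly_Cauchy s x"
  unfolding weakly_null_def weakly_Cauchy_def by (blast intro: LIMSEQ_imp_Cauchy)

text \<open>
  A functional \<open>f\<close> turns the \<open>n\<close>-th difference into one between two members of the tail from \<open>n\<close> on of the Cauchy sequence \<open>f \<circ> x\<close>.
\<close>

lemma weakly_Cauchy_imp_weakly_null_diff:
  assumes "weakly_Cauchy s x" and "\<And>n. n \<le> k n" and "\<And>n. n \<le> l n"
  shows "weakly_null s (\<lambda>n. x (k n) - x (l n))"
  unfolding weakly_null_def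
proof (intro allI impI)
  fix f assume f: "continuous_linear s (*) f"
  then interpret L: Vector_Spaces.linear s "(*)" f
    by (simp add: continuous_linear_def)
  have "Cauchy (\<lambda>n. f (x n))"
    using assms(1) f by (simp add: weakly_Cauchy_def)
  then have "\<exists>N. \<forall>n\<ge>N. norm (f (x (k n) - x (l n))) < e" if e: "e > 0" for e
  proof -
    obtain N where "\<And>i j. i \<ge> N \<Longrightarrow> j \<ge> N \<Longrightarrow> norm (f (x i) - f (x j)) < e"
      using CauchyD[OF \<open>Cauchy _\<close> e] by blast
    then have "\<forall>n\<ge>N. norm (f (x (k n) - x (l n))) < e"
      using assms(2,3) order_trans by (simp add: L.diff) blast
    then show ?thesis ..
  qed
  then show "(\<lambda>n. f (x (k n) - x (l n))) \<longlonglongrightarrow> 0"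
    by (simp add: LIMSEQ_iff)
qed

lemma weakly_null_scaleR:
  fixes s :: "'k::real_normed_field \<Rightarrow> 'a::banach \<Rightarrow> 'a"
  assumes s: "banach_space_over s" and x: "weakly_null s x"
  shows "weakly_null s (\<lambda>n. r *\<^sub>R x n)"
  unfolding weakly_null_def
proof (intro allI impI)
  fix f assume f: "continuous_linear s (*) f"
  interpret S: banach_space_over s by (fact s)
  interpret L: Vector_Spaces.linear s "(*)" f
    using f by (simp add: continuous_linear_def)
  have "f (r *\<^sub>R v) = of_real r * f v" for v
    by (metis S.scale_of_real L.scale)
  moreover have "(\<lambda>n. of_real r * f (x n)) \<longlonglongrightarrow> 0"
    using x f by (auto simp: weakly_null_def intro: tendsto_mult_right_zero)
  ultimately show "(\<lambda>n. f (r *\<^sub>R x n)) \<longlonglongrightarrow> 0"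
    by simp
qed

definition interleave_zero :: "(nat \<Rightarrow> 'a::zero) \<Rightarrow> nat \<Rightarrow> 'a" where
  "interleave_zero x n = (if even n then x (n div 2) else 0)"

lemma weakly_null_interleave_zero:
  assumes "weakly_null s x"
  shows "weakly_null s (interleave_zero x)"
  unfolding weakly_null_def
proof (intro allI impI)
  fix f assume f: "continuous_linear s (*) f"
  then interpret L: Vector_Spaces.linear s "(*)" f
    by (simp add: continuous_linear_def)
  have "(\<lambda>n. f (x n)) \<longlonglongrightarrow> 0"
    using assms f by (simp add: weakly_null_def)
  moreover have "filterlim (\<lambda>n::nat. n div 2) at_top at_top"
    by (rule filterlim_at_top_div_const_nat) simp
  ultimately have "(\<lambda>n. f (x (n div 2))) \<longlonglongrightarrow> 0"
    by (rule filterlim_compose)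
  then have "(\<lambda>n. norm (f (x (n div 2)))) \<longlonglongrightarrow> 0"
    by (rule tendsto_norm_zero)
  moreover have "norm (f (interleave_zero x n)) \<le> norm (f (x (n div 2)))" for n
    by (simp add: interleave_zero_def)
  then have "\<forall>\<^sub>F n in sequentially.
      norm (f (interleave_zero x n)) \<le> norm (f (x (n div 2)))"
    by (rule always_eventually[OF allI])
  ultimately show "(\<lambda>n. f (interleave_zero x n)) \<longlonglongrightarrow> 0"
    by (rule Lim_null_comparison[rotated])
qed

text \<open>
  Every tail of the interleaved sequence contains zeros as well as a tail of \<open>y\<close>, so its
  diameter bounds the norms in that tail of \<open>y\<close>.
\<close>

lemma limsup_norm_le_ca_interleave_zero:
  "limsup (\<lambda>n. ereal (norm (y n))) \<le> ca (interleave_zero y)"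
  unfolding limsup_INF_SUP ca_def
proof (intro INF_mono[OF bexI] SUP_least)
  fix n m :: nat assume "m \<in> {n..}"
  \<comment> \<open>The \<open>m\<close>-th term sits at position \<open>2 * m\<close>, directly before a zero.\<close>
  then show "ereal (norm (y m))
      \<le> Sup {ereal (norm (interleave_zero y k - interleave_zero y l)) | k l. n \<le> k \<and> n \<le> l}"
    by (intro Sup_upper CollectI exI[of _ "2 * m"] exI[of _ "Suc (2 * m)"])
      (simp add: interleave_zero_def)
qed simp

lemma limsup_norm_le_cc:
  assumes "Vector_Spaces.linear s t T"
    and "range x \<subseteq> cball 0 1" and "weakly_null s x"
  shows "limsup (\<lambda>n. ereal (norm (T (x n)))) \<le> cc s T"
proof -
  interpret L: Vector_Spaces.linear s t T by fact
  have "(\<lambda>n. T (interleave_zero x n)) = interleave_zero (\<lambda>n. T (x n))"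
    by (auto simp: interleave_zero_def)
  moreover have "range (interleave_zero x) \<subseteq> cball 0 1"
    using assms(2) by (auto simp: interleave_zero_def)
  moreover have "weakly_Cauchy s (interleave_zero x)"
    using assms(3) by (intro weakly_null_imp_weakly_Cauchy weakly_null_interleave_zero)
  ultimately have "ca (interleave_zero (\<lambda>n. T (x n))) \<le> cc s T"
    unfolding cc_def by (intro Sup_upper CollectI exI[of _ "interleave_zero x"]) simp
  with limsup_norm_le_ca_interleave_zero show ?thesis
    by (rule order_trans)
qed

lemma ca_le_twice_cc_n:
  fixes s :: "'k::real_normed_field \<Rightarrow> 'a::banach \<Rightarrow> 'a"
    and t :: "'k \<Rightarrow> 'b::banach \<Rightarrow> 'b"
  assumes s: "banach_space_over s" and t: "banach_space_over t"
    and T: "Vector_Spaces.linear s t T"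
    and ball: "range x \<subseteq> cball 0 1" and x: "weakly_Cauchy s x"
  shows "ca (\<lambda>n. T (x n)) \<le> 2 * cc_n s T"
proof (rule dense_le)
  interpret L: Vector_Spaces.linear s t T by (fact T)
  fix z assume "z < ca (\<lambda>n. T (x n))"
  then have "z < Sup {ereal (norm (T (x k) - T (x l))) | k l. n \<le> k \<and> n \<le> l}" for n
    unfolding ca_def by (rule less_INF_D) simp
  then have "\<exists>k l. n \<le> k \<and> n \<le> l \<and> z < ereal (norm (T (x k) - T (x l)))" for n
    unfolding less_Sup_iff by blast
  then obtain k l where kl: "\<And>n. n \<le> k n" "\<And>n. n \<le> l n"
    and z: "\<And>n. z < ereal (norm (T (x (k n)) - T (x (l n))))"
    by metis
  \<comment> \<open>The factor \<open>1/2\<close> brings the differences back into the unit ball.\<close>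
  define y where "y n = (1/2) *\<^sub>R (x (k n) - x (l n))" for n
  have "norm (y n) \<le> 1" for n
  proof -
    have "norm (x i) \<le> 1" for i
      using ball by (simp add: image_subset_iff)
    from this[of "k n"] this[of "l n"] have "norm (x (k n) - x (l n)) \<le> 2"
      using norm_triangle_ineq4[of "x (k n)" "x (l n)"] by linarith
    then show ?thesis
      by (simp add: y_def)
  qed
  then have "range y \<subseteq> cball 0 1"
    by auto
  moreover have "weakly_null s y"
    unfolding y_def
    using weakly_null_scaleR[OF s weakly_Cauchy_imp_weakly_null_diff[OF x kl]] .
  ultimately have y: "limsup (\<lambda>n. ereal (norm (T (y n)))) \<le> cc_n s T"
    unfolding cc_n_def by (intro Sup_upper) auto
  have "z \<le> 2 * ereal (norm (T (y n)))" for n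
    using less_imp_le[OF z[of n]]
    by (simp add: y_def linear_scaleR_over[OF s t T] L.diff)
  then have "z \<le> limsup (\<lambda>n. 2 * ereal (norm (T (y n))))"
    by (intro le_Limsup) auto
  also have "\<dots> = 2 * limsup (\<lambda>n. ereal (norm (T (y n))))"
    using Limsup_ereal_mult_left[of sequentially 2 "\<lambda>n. ereal (norm (T (y n)))"] by simp
  also have "\<dots> \<le> 2 * cc_n s T"
    using y by (intro ereal_mult_left_mono) auto
  finally show "z \<le> 2 * cc_n s T" .
qed

theorem theorem4p1:
  fixes scaleX :: "'k::real_normed_field \<Rightarrow> 'a::banach \<Rightarrow> 'a"
    and scaleY :: "'k \<Rightarrow> 'b::banach \<Rightarrow> 'b"
    and T :: "'a \<Rightarrow> 'b"
  assumes "banach_space_over scaleX"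
    and "banach_space_over scaleY"
    and "continuous_linear scaleX scaleY T"
  shows "cc_n scaleX T \<le> cc scaleX T \<and> cc scaleX T \<le> 2 * cc_n scaleX T"
proof
  have T: "Vector_Spaces.linear scaleX scaleY T"
    using assms(3) by (simp add: continuous_linear_def)
  show "cc_n scaleX T \<le> cc scaleX T"
    unfolding cc_n_def using limsup_norm_le_cc[OF T] by (blast intro: Sup_least)
  show "cc scaleX T \<le> 2 * cc_n scaleX T"
    unfolding cc_def using ca_le_twice_cc_n[OF assms(1,2) T] by (blast intro: Sup_least)
qed

end
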